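(* Let $G$ be a finite group and let $\Bbbk$ be an algebraically closed field of arbitrary characteristic. Let $n\ge 1$. For all $g_i,x_i,h_i,y_i\in G$ ($1\le i\le n$) and all $k,z\in G$, the linear map $\mathrm{Cor}_{n;1,1}: K^{\otimes n}\otimes F\to F$ associated with the Drinfeld double $\mathcal{D}G$ satisfies $$\mathrm{Cor}_{n;1,1}\big(\beta_{g_1|x_1}\otimes\beta_{h_1|y_1}\otimes\cdots\otimes\beta_{g_n|x_n}\otimes\beta_{h_n|y_n}\otimes\beta_{k|z}\big)=\Big(\prod_{i=1}^n \delta_{y_i^{-1},\,z^{-1}x_iz}\;\delta_{y_i^{-1}h_iy_i,\,z^{-1}g_iz}\Big)\,\beta_{k[x_n,g_n]\cdots[x_1,g_1]\,|\,z},$$ where $[x,g]:=x^{-1}g^{-1}xg$.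
   Context: The Drinfeld double $\mathcal{D}G=\Bbbk(G)\otimes_{\Bbbk}\Bbbk[G]$ has basis $b_{g|x}:=\delta_g\otimes b_x$ ($g,x\in G$), where $\delta_g$ and $b_x$ are the usual bases of the function algebra $\Bbbk(G)$ and of the group algebra $\Bbbk[G]$. Let $\{\beta_{g|x}\}_{g,x\in G}$ be the dual basis of $\mathcal{D}G^*$. The symbol $\delta_{a,b}$ (for $a,b\in G$) is $1$ if $a=b$ and $0$ otherwise, and $\otimes$ is over $\Bbbk$. As vector spaces, $F=\mathcal{D}G^*$ and $K=\mathcal{D}G^*\otimes\mathcal{D}G^*$. On $F$ there are the linear maps (product and coproduct of a Frobenius algebra) $$m_F(\beta_{g|x}\otimes\beta_{h|y})=\delta_{x,y}\,\beta_{hg|x},\qquad \Delta_F(\beta_{g|x})=\sum_{h\in G}\beta_{h^{-1}g|x}\otimes\beta_{h|x},$$ and $K$ acts on $F$ by the linear map $\rho^K_F:K\otimes F\to F$, $$\rho^K_F(\beta_{g|x}\otimes\beta_{h|y}\otimes\beta_{k|z})=\delta_{z,\,xzy}\;\delta_{k,x}\;\beta_{g^{-1}xg\,|\,g^{-1}zy^{-1}hy}.$$ The maps $\mathrm{Cor}_{n;1,1}:K^{\otimes n}\otimes F\to F$ are defined by $$\mathrm{Cor}_{1;1,1}:=m_F\circ(\rho^K_F\otimes \mathrm{id}_F)\circ(\mathrm{id}_K\otimes\Delta_F),\qquad \mathrm{Cor}_{n;1,1}:=\mathrm{Cor}_{1;1,1}\circ(\mathrm{id}_K\otimes\mathrm{Cor}_{n-1;1,1})\quad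 (n>1).$$ *)

theory Defs
  imports "HOL-Computational_Algebra.Polynomial" "HOL-Algebra.Group"
begin

(* The group is an object with a carrier, so a function on the group is a total function that
   vanishes off the carrier.  All vector spaces below are spaces of scalar-valued functions with
   pointwise operations. *)

definition kron :: "'a \<Rightarrow> 'a \<Rightarrow> 'k::field" where
  "kron a b = (if a = b then 1 else 0)"

definition commutator :: "('g, 'm) monoid_scheme \<Rightarrow> 'g \<Rightarrow> 'g \<Rightarrow> 'g" where
  "commutator G x g = inv\<^bsub>G\<^esub> x \<otimes>\<^bsub>G\<^esub> inv\<^bsub>G\<^esub> g \<otimes>\<^bsub>G\<^esub> x \<otimes>\<^bsub>G\<^esub> g"


section \<open>The Drinfeld double, its dual, and tensor powers of the dual\<close>

text \<open>
  An element of the double is a tensor in (functions on the group) \<open>\<otimes>\<close> (group algebra); its value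
  at \<open>(g, x)\<close> is the coefficient of \<open>\<delta>\<^sub>g \<otimes> b\<^sub>x\<close>.
\<close>

type_synonym ('g, 'k) dbl = "'g \<times> 'g \<Rightarrow> 'k"

definition Double :: "('g, 'm) monoid_scheme \<Rightarrow> ('g, 'k::field) dbl set" where
  "Double G = {w. \<forall>p. p \<notin> carrier G \<times> carrier G \<longrightarrow> w p = 0}"

definition dbl_basis :: "'g \<Rightarrow> 'g \<Rightarrow> ('g, 'k::field) dbl" where
  "dbl_basis g x = (\<lambda>(h, y). kron g h * kron x y)"

text \<open>
  The dual basis: \<open>\<beta> G g x\<close> is the coefficient functional on the double belonging to
  \<open>dbl_basis g x\<close> (and, by convention, 0 off the double).
\<close>

definition \<beta> :: "('g, 'm) monoid_scheme \<Rightarrow> 'g \<Rightarrow> 'g \<Rightarrow> ('g, 'k::field) dbl \<Rightarrow> 'k" where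
  "\<beta> G g x = (\<lambda>w. if w \<in> Double G then w (g, x) else 0)"

text \<open>
  Since the double is finite-dimensional, the \<open>n\<close>-th tensor power of its dual is the space of
  \<open>n\<close>-linear forms on it.  The argument tuples are lists of length \<open>n\<close>, and a form is 0 on all
  other lists.  In this model tensor powers are strictly associative; a form of degree 1 is an
  element of \<open>F\<close>, one of degree 2 an element of \<open>K\<close>, and one of degree \<open>2 * n + 1\<close> an element of
  the tensor product of \<open>n\<close> copies of \<open>K\<close> with \<open>F\<close>.
\<close>

type_synonym ('g, 'k) form = "('g, 'k) dbl list \<Rightarrow> 'k"

definition tensor_power :: "('g, 'm) monoid_scheme \<Rightarrow> nat \<Rightarrow> ('g, 'k::field) form set" where
  "tensor_power G n = {T.
     (\<forall>ws. \<not> (length ws = n \<and> set ws \<subseteq> Double G) \<longrightarrow> T ws = 0) \<and>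
     (\<forall>us vs u v c. length us + length vs + 1 = n \<longrightarrow> set (us @ vs) \<subseteq> Double G \<longrightarrow>
        u \<in> Double G \<longrightarrow> v \<in> Double G \<longrightarrow>
        T (us @ (\<lambda>p. c * u p + v p) # vs) = c * T (us @ u # vs) + T (us @ v # vs))}"

text \<open>\<open>tensor [\<phi>\<^sub>1, \<dots>, \<phi>\<^sub>n]\<close> is the elementary tensor of the functionals \<open>\<phi>\<^sub>1, \<dots>, \<phi>\<^sub>n\<close>.\<close>

definition tensor :: "(('g, 'k::field) dbl \<Rightarrow> 'k) list \<Rightarrow> ('g, 'k) form" where
  "tensor \<phi>s = (\<lambda>ws. if length ws = length \<phi>s then \<Prod>i<length \<phi>s. (\<phi>s ! i) (ws ! i) else 0)"

text \<open>
  The tensor product of two forms.  The sum saves mentioning degrees: if \<open>S\<close> has degree \<open>m\<close>,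
  only the summand \<open>i = m\<close> contributes.
\<close>

definition form_tensor ::
    "('g, 'k::field) form \<Rightarrow> ('g, 'k) form \<Rightarrow> ('g, 'k) form" (infixr "\<otimes>\<^sub>t" 70) where
  "S \<otimes>\<^sub>t T = (\<lambda>ws. \<Sum>i\<le>length ws. S (take i ws) * T (drop i ws))"

definition idx :: "('g, 'm) monoid_scheme \<Rightarrow> nat \<Rightarrow> ('g \<times> 'g) list set" where
  "idx G n = {I. length I = n \<and> set I \<subseteq> carrier G \<times> carrier G}"

abbreviation bs :: "('g \<times> 'g) list \<Rightarrow> ('g, 'k::field) dbl list" where
  "bs I \<equiv> map (\<lambda>(g, x). dbl_basis g x) I"

abbreviation \<beta>s :: "('g, 'm) monoid_scheme \<Rightarrow> ('g \<times> 'g) list \<Rightarrow> ('g, 'k::field) form" where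
  "\<beta>s G I \<equiv> tensor (map (\<lambda>(g, x). \<beta> G g x) I)"

text \<open>
  The tensor product of linear maps \<open>\<Phi>\<close>, defined on degree \<open>m\<close>, and \<open>\<Psi>\<close>, defined on degree \<open>n\<close>.
  As for all maps below, the value on \<open>T\<close> is obtained by linear extension from the basis of
  tensors of the \<open>\<beta>\<close>'s; the coordinates of \<open>T\<close> in that basis are its values on tuples of
  basis vectors of the double.
\<close>

definition map_tensor :: "('g, 'm) monoid_scheme \<Rightarrow> nat \<Rightarrow> nat \<Rightarrow>
    (('g, 'k::field) form \<Rightarrow> ('g, 'k) form) \<Rightarrow> (('g, 'k) form \<Rightarrow> ('g, 'k) form) \<Rightarrow>
    ('g, 'k) form \<Rightarrow> ('g, 'k) form" where
  "map_tensor G m n \<Phi> \<Psi> T = (\<lambda>ws. \<Sum>I\<in>idx G m. \<Sum>J\<in>idx G n.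
     T (bs I @ bs J) * (\<Phi> (\<beta>s G I) \<otimes>\<^sub>t \<Psi> (\<beta>s G J)) ws)"


section \<open>The structure maps\<close>

definition m_F :: "('g, 'm) monoid_scheme \<Rightarrow> ('g, 'k::field) form \<Rightarrow> ('g, 'k) form" where
  "m_F G T = (\<lambda>ws. \<Sum>g\<in>carrier G. \<Sum>x\<in>carrier G. \<Sum>h\<in>carrier G. \<Sum>y\<in>carrier G.
     T [dbl_basis g x, dbl_basis h y] *
     (kron x y * tensor [\<beta> G (h \<otimes>\<^bsub>G\<^esub> g) x] ws))"

definition \<Delta>_F :: "('g, 'm) monoid_scheme \<Rightarrow> ('g, 'k::field) form \<Rightarrow> ('g, 'k) form" where
  "\<Delta>_F G T = (\<lambda>ws. \<Sum>g\<in>carrier G. \<Sum>x\<in>carrier G.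
     T [dbl_basis g x] *
     (\<Sum>h\<in>carrier G. tensor [\<beta> G (inv\<^bsub>G\<^esub> h \<otimes>\<^bsub>G\<^esub> g) x, \<beta> G h x] ws))"

definition \<rho>_KF :: "('g, 'm) monoid_scheme \<Rightarrow> ('g, 'k::field) form \<Rightarrow> ('g, 'k) form" where
  "\<rho>_KF G T = (\<lambda>ws. \<Sum>g\<in>carrier G. \<Sum>x\<in>carrier G. \<Sum>h\<in>carrier G. \<Sum>y\<in>carrier G.
     \<Sum>k\<in>carrier G. \<Sum>z\<in>carrier G.
     T [dbl_basis g x, dbl_basis h y, dbl_basis k z] *
     (kron z (x \<otimes>\<^bsub>G\<^esub> z \<otimes>\<^bsub>G\<^esub> y) * kron k x *
      tensor [\<beta> G (inv\<^bsub>G\<^esub> g \<otimes>\<^bsub>G\<^esub> x \<otimes>\<^bsub>G\<^esub> g)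
                  (inv\<^bsub>G\<^esub> g \<otimes>\<^bsub>G\<^esub> z \<otimes>\<^bsub>G\<^esub> inv\<^bsub>G\<^esub> y \<otimes>\<^bsub>G\<^esub> h \<otimes>\<^bsub>G\<^esub> y)] ws))"

definition Cor1 :: "('g, 'm) monoid_scheme \<Rightarrow> ('g, 'k::field) form \<Rightarrow> ('g, 'k) form" where
  "Cor1 G = m_F G \<circ> map_tensor G 3 1 (\<rho>_KF G) id \<circ> map_tensor G 2 1 id (\<Delta>_F G)"

text \<open>
  \<open>Cor G n\<close> is the map with domain the tensor product of \<open>n\<close> copies of \<open>K\<close> with \<open>F\<close>.
  It is only of interest for \<open>n \<ge> 1\<close>.
\<close>

fun Cor :: "('g, 'm) monoid_scheme \<Rightarrow> nat \<Rightarrow> ('g, 'k::field) form \<Rightarrow> ('g, 'k) form" where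
  "Cor G 0 = id"
| "Cor G (Suc 0) = Cor1 G"
| "Cor G (Suc (Suc n)) = Cor1 G \<circ> map_tensor G 2 (2 * Suc n + 1) id (Cor G (Suc n))"

section \<open>Properties of the model\<close>

text \<open>
  Tensors of the \<open>\<beta>\<close>'s form a basis of \<open>tensor_power\<close> with the coordinates used above
  (\<open>\<beta>s_mem\<close>, \<open>\<beta>s_bs\<close>, \<open>tensor_power_expand\<close>), and the maps are linear with the prescribed
  values on basis tensors.
\<close>

lemma dbl_basis_mem: "g \<in> carrier G \<Longrightarrow> x \<in> carrier G \<Longrightarrow> dbl_basis g x \<in> Double G"
  by (auto simp: Double_def dbl_basis_def kron_def)

lemma \<beta>_dbl_basis:
  assumes "g \<in> carrier G" "x \<in> carrier G"
  shows "\<beta> G h y (dbl_basis g x) = kron h g * kron y x"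
  using dbl_basis_mem[OF assms] by (auto simp: \<beta>_def dbl_basis_def kron_def)

lemma tensor_Nil: "tensor [] ws = (if ws = [] then 1 else 0)"
  by (simp add: tensor_def)

lemma tensor_Cons:
  "tensor (\<phi> # \<phi>s) ws = (case ws of [] \<Rightarrow> 0 | w # ws' \<Rightarrow> \<phi> w * tensor \<phi>s ws')"
  by (cases ws) (auto simp: tensor_def prod.lessThan_Suc_shift simp del: prod.lessThan_Suc)

lemma \<beta>s_bs:
  assumes "set J \<subseteq> carrier G \<times> carrier G"
  shows "\<beta>s G I (bs J) = kron I J"
  using assms
proof (induction I arbitrary: J)
  case Nil
  then show ?case by (auto simp: tensor_Nil kron_def)
next
  case (Cons p I)
  show ?case
  proof (cases J)
    case Nil
    then show ?thesis by (simp add: tensor_Cons kron_def)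
  next
    case J: (Cons q J')
    obtain a b c d where pq: "p = (a, b)" "q = (c, d)" by fastforce
    have cd: "c \<in> carrier G" "d \<in> carrier G" using Cons.prems J pq by auto
    have "\<beta>s G I (bs J') = (kron I J' :: 'c)" using Cons J by auto
    then show ?thesis
      using J pq by (auto simp: tensor_Cons \<beta>_dbl_basis[OF cd] kron_def)
  qed
qed

lemma tensor_append:
  "tensor (\<phi>s @ \<psi>s) = tensor \<phi>s \<otimes>\<^sub>t tensor \<psi>s"
proof
  fix ws :: "('a, 'b) dbl list"
  have "tensor \<phi>s (take i ws) * tensor \<psi>s (drop i ws) =
      (if i = length \<phi>s then tensor (\<phi>s @ \<psi>s) ws else 0)" if "i \<le> length ws" for i
  proof (cases "i = length \<phi>s")
    case False
    then show ?thesis using that by (simp add: tensor_def)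
  next
    case True
    have "tensor (\<phi>s @ \<psi>s) ws = tensor \<phi>s (take (length \<phi>s) ws) * tensor \<psi>s (drop (length \<phi>s) ws)"
      if "length \<phi>s \<le> length ws" for ws
      using that
    proof (induction \<phi>s arbitrary: ws)
      case Nil
      then show ?case by (simp add: tensor_Nil)
    next
      case (Cons \<phi> \<phi>s)
      then show ?case by (cases ws) (auto simp: tensor_Cons)
    qed
    then show ?thesis using that True by simp
  qed
  then have "(tensor \<phi>s \<otimes>\<^sub>t tensor \<psi>s) ws =
      (\<Sum>i\<le>length ws. if i = length \<phi>s then tensor (\<phi>s @ \<psi>s) ws else 0)"
    by (simp add: form_tensor_def)
  also have "\<dots> = tensor (\<phi>s @ \<psi>s) ws"
    by (auto simp: tensor_def)
  finally show "tensor (\<phi>s @ \<psi>s) ws = (tensor \<phi>s \<otimes>\<^sub>t tensor \<psi>s) ws" by simp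
qed

lemma finite_idx: "finite (carrier G) \<Longrightarrow> finite (idx G n)"
  unfolding idx_def using finite_lists_length_eq[of "carrier G \<times> carrier G" n]
  by (simp add: conj_commute)

lemma sum_kron_left:
  "finite A \<Longrightarrow> a \<in> A \<Longrightarrow> (\<Sum>b\<in>A. kron a b * f b) = (f a :: 'k::field)"
  by (simp add: kron_def of_bool_def if_distrib[of "\<lambda>c. c * _"] sum.delta cong: if_cong)

lemma kron_append:
  "length I = length I' \<Longrightarrow> kron (I @ J) (I' @ J') = kron I I' * (kron J J' :: 'k::field)"
  by (simp add: kron_def)

lemma map_tensor_basis:
  fixes G :: "('g, 'm) monoid_scheme" and \<Phi> \<Psi> :: "('g, 'k::field) form \<Rightarrow> ('g, 'k) form"
  assumes fin: "finite (carrier G)" and "I \<in> idx G m" "J \<in> idx G n"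
  shows "map_tensor G m n \<Phi> \<Psi> (\<beta>s G (I @ J)) = \<Phi> (\<beta>s G I) \<otimes>\<^sub>t \<Psi> (\<beta>s G J)"
proof
  fix ws
  have "map_tensor G m n \<Phi> \<Psi> (\<beta>s G (I @ J)) ws =
    (\<Sum>I'\<in>idx G m. \<Sum>J'\<in>idx G n. kron (I @ J) (I' @ J') * (\<Phi> (\<beta>s G I') \<otimes>\<^sub>t \<Psi> (\<beta>s G J')) ws)"
    unfolding map_tensor_def
  proof (intro sum.cong refl)
    fix I' J' assume "I' \<in> idx G m" "J' \<in> idx G n"
    then have "set (I' @ J') \<subseteq> carrier G \<times> carrier G" by (auto simp: idx_def)
    then have "\<beta>s G (I @ J) (bs (I' @ J')) = (kron (I @ J) (I' @ J') :: 'k)"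
      by (rule \<beta>s_bs)
    then show "\<beta>s G (I @ J) (bs I' @ bs J') * (\<Phi> (\<beta>s G I') \<otimes>\<^sub>t \<Psi> (\<beta>s G J')) ws =
        kron (I @ J) (I' @ J') * (\<Phi> (\<beta>s G I') \<otimes>\<^sub>t \<Psi> (\<beta>s G J')) ws"
      by simp
  qed
  also have "\<dots> = (\<Sum>I'\<in>idx G m. kron I I' *
      (\<Sum>J'\<in>idx G n. kron J J' * (\<Phi> (\<beta>s G I') \<otimes>\<^sub>t \<Psi> (\<beta>s G J')) ws))"
    unfolding sum_distrib_left
    by (intro sum.cong refl) (use assms in \<open>auto simp: idx_def kron_append mult.assoc\<close>)
  also have "\<dots> = (\<Phi> (\<beta>s G I) \<otimes>\<^sub>t \<Psi> (\<beta>s G J)) ws"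
    using assms by (simp add: sum_kron_left finite_idx)
  finally show "map_tensor G m n \<Phi> \<Psi> (\<beta>s G (I @ J)) ws = (\<Phi> (\<beta>s G I) \<otimes>\<^sub>t \<Psi> (\<beta>s G J)) ws" .
qed

lemma tensor_\<beta>_eval:
  assumes "c \<in> carrier G" "d \<in> carrier G"
  shows "tensor (\<beta> G a b # \<phi>s) (dbl_basis c d # ws) = kron a c * (kron b d * tensor \<phi>s ws)"
  using assms by (simp add: tensor_Cons \<beta>_dbl_basis)

lemma m_F_basis:
  assumes "finite (carrier G)" "g \<in> carrier G" "x \<in> carrier G" "h \<in> carrier G" "y \<in> carrier G"
  shows "m_F G (tensor [\<beta> G g x, \<beta> G h y]) =
    (\<lambda>ws. kron x y * tensor [\<beta> G (h \<otimes>\<^bsub>G\<^esub> g) x] ws)"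
  using assms
  by (simp add: m_F_def tensor_\<beta>_eval tensor_Nil mult.assoc sum_kron_left
      flip: sum_distrib_left cong: sum.cong)

lemma \<Delta>_F_basis:
  assumes "finite (carrier G)" "g \<in> carrier G" "x \<in> carrier G"
  shows "\<Delta>_F G (tensor [\<beta> G g x]) =
    (\<lambda>ws. \<Sum>h\<in>carrier G. tensor [\<beta> G (inv\<^bsub>G\<^esub> h \<otimes>\<^bsub>G\<^esub> g) x, \<beta> G h x] ws)"
  using assms
  by (simp add: \<Delta>_F_def tensor_\<beta>_eval tensor_Nil mult.assoc sum_kron_left
      flip: sum_distrib_left cong: sum.cong)

lemma \<rho>_KF_basis:
  assumes "finite (carrier G)" "g \<in> carrier G" "x \<in> carrier G" "h \<in> carrier G" "y \<in> carrier G"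
    "k \<in> carrier G" "z \<in> carrier G"
  shows "\<rho>_KF G (tensor [\<beta> G g x, \<beta> G h y, \<beta> G k z]) =
    (\<lambda>ws. kron z (x \<otimes>\<^bsub>G\<^esub> z \<otimes>\<^bsub>G\<^esub> y) * kron k x *
      tensor [\<beta> G (inv\<^bsub>G\<^esub> g \<otimes>\<^bsub>G\<^esub> x \<otimes>\<^bsub>G\<^esub> g)
                  (inv\<^bsub>G\<^esub> g \<otimes>\<^bsub>G\<^esub> z \<otimes>\<^bsub>G\<^esub> inv\<^bsub>G\<^esub> y \<otimes>\<^bsub>G\<^esub> h \<otimes>\<^bsub>G\<^esub> y)] ws)"
  using assms
  by (simp add: \<rho>_KF_def tensor_\<beta>_eval tensor_Nil mult.assoc sum_kron_left
      flip: sum_distrib_left cong: sum.cong)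

lemma form_additive:
  assumes "T \<in> tensor_power G n" "length us + length vs + 1 = n" "set (us @ vs) \<subseteq> Double G"
    "finite A" "\<And>a. a \<in> A \<Longrightarrow> u a \<in> Double G"
  shows "T (us @ (\<lambda>p. \<Sum>a\<in>A. c a * u a p) # vs) = (\<Sum>a\<in>A. c a * T (us @ u a # vs))"
proof -
  have lin: "T (us @ (\<lambda>p. d * u p + v p) # vs) = d * T (us @ u # vs) + T (us @ v # vs)"
    if "u \<in> Double G" "v \<in> Double G" for u v d
    using assms(1-3) that by (simp add: tensor_power_def)
  have z: "(\<lambda>_. 0) \<in> Double G" by (simp add: Double_def)
  have T0: "T (us @ (\<lambda>_. 0) # vs) = 0" using lin[OF z z, of "-1"] by simp
  show ?thesis using assms(4,5)
  proof (induction A rule: finite_induct)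
    case empty
    then show ?case using T0 by simp
  next
    case (insert a A)
    have "(\<lambda>p. \<Sum>a\<in>A. c a * u a p) \<in> Double G"
      using insert.prems by (auto simp: Double_def intro!: sum.neutral)
    with insert show ?case by (simp add: lin)
  qed
qed

lemma Double_expand:
  assumes "w \<in> Double G" "finite (carrier G)"
  shows "w = (\<lambda>p. \<Sum>q\<in>carrier G \<times> carrier G. w q * (case q of (g, x) \<Rightarrow> dbl_basis g x) p)"
proof
  fix p
  have "(\<Sum>q\<in>carrier G \<times> carrier G. w q * (case q of (g, x) \<Rightarrow> dbl_basis g x) p)
      = (\<Sum>q\<in>carrier G \<times> carrier G. if q = p then w p else 0)"
    by (intro sum.cong refl) (auto simp: dbl_basis_def kron_def split: prod.splits)
  also have "\<dots> = w p"
    using assms by (cases p) (auto simp: Double_def)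
  finally show "w p = (\<Sum>q\<in>carrier G \<times> carrier G. w q * (case q of (g, x) \<Rightarrow> dbl_basis g x) p)" ..
qed

lemma tensor_power_expand:
  fixes G :: "('g, 'm) monoid_scheme" and T :: "('g, 'k::field) form"
  assumes T: "T \<in> tensor_power G n" and fin: "finite (carrier G)"
  shows "T = (\<lambda>ws. \<Sum>I\<in>idx G n. T (bs I) * \<beta>s G I ws)"
proof
  fix ws
  show "T ws = (\<Sum>I\<in>idx G n. T (bs I) * \<beta>s G I ws)"
  proof (cases "length ws = n \<and> set ws \<subseteq> Double G")
    case False
    then have "\<beta>s G I ws = 0" if "I \<in> idx G n" for I
    proof (cases "length ws = n")
      case True
      with False obtain w where "w \<in> set ws" "w \<notin> Double G" by auto
      then obtain i where i: "i < n" "ws ! i \<notin> Double G" using True by (auto simp: in_set_conv_nth)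
      have "length I = n" using that by (simp add: idx_def)
      with i True show ?thesis
        by (auto simp: tensor_def \<beta>_def split: prod.splits intro!: prod_zero bexI[of _ i])
    qed (use that in \<open>simp add: tensor_def idx_def\<close>)
    moreover have "T ws = 0" using T False by (auto simp: tensor_power_def)
    ultimately show ?thesis by simp
  next
    case True
    have "T (us @ vs) = (\<Sum>I\<in>idx G (length vs). T (us @ bs I) * \<beta>s G I vs)"
      if "length us + length vs = n" "set us \<subseteq> Double G" "set vs \<subseteq> Double G" for us vs
      using that
    proof (induction vs arbitrary: us)
      case Nil
      have "idx G 0 = {[]}" by (auto simp: idx_def)
      then show ?case by (simp add: tensor_Nil)
    next
      case (Cons v vs)
      let ?P = "carrier G \<times> carrier G"
      let ?b = "\<lambda>(g, x). dbl_basis g x :: ('g, 'k) dbl"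
      have b: "?b q \<in> Double G" if "q \<in> ?P" for q using that dbl_basis_mem[of _ G] by auto
      have v: "v \<in> Double G" using Cons.prems by simp
      have \<beta>v: "\<beta> G g x v = v (g, x)" for g x using v by (simp add: \<beta>_def)
      have "T (us @ v # vs) = T (us @ (\<lambda>p. \<Sum>q\<in>?P. v q * ?b q p) # vs)"
        using Double_expand[OF v fin] by simp
      also have "\<dots> = (\<Sum>q\<in>?P. v q * T (us @ ?b q # vs))"
        by (rule form_additive[OF T]) (use Cons.prems fin b in auto)
      also have "\<dots> = (\<Sum>q\<in>?P. v q * (\<Sum>I\<in>idx G (length vs). T ((us @ [?b q]) @ bs I) * \<beta>s G I vs))"
        (is "_ = ?R")
      proof (intro sum.cong refl)
        fix q assume "q \<in> ?P"
        then show "v q * T (us @ ?b q # vs) =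
          v q * (\<Sum>I\<in>idx G (length vs). T ((us @ [?b q]) @ bs I) * \<beta>s G I vs)"
          using Cons.IH[of "us @ [?b q]"] Cons.prems b[of q] by simp
      qed
      also have "?R = (\<Sum>(q, I)\<in>?P \<times> idx G (length vs). T (us @ bs (q # I)) * \<beta>s G (q # I) (v # vs))"
        unfolding sum_distrib_left sum.cartesian_product
        by (intro sum.cong refl) (auto simp: tensor_Cons \<beta>v)
      also have "\<dots> = (\<Sum>I\<in>idx G (length (v # vs)). T (us @ bs I) * \<beta>s G I (v # vs))"
        by (rule sum.reindex_bij_witness[where i = "\<lambda>I. (hd I, tl I)" and j = "\<lambda>(q, I). q # I"])
          (auto simp: idx_def length_Suc_conv)
      finally show ?case .
    qed
    from this[of "[]" ws] True show ?thesis by simp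
  qed
qed

lemma \<beta>s_mem:
  fixes G :: "('g, 'm) monoid_scheme"
  assumes n: "length I = n"
  shows "(\<beta>s G I :: ('g, 'k::field) form) \<in> tensor_power G n"
proof -
  have \<beta>: "\<beta> G g x (\<lambda>p. c * u p + v p) = c * \<beta> G g x u + \<beta> G g x v"
    if "u \<in> Double G" "v \<in> Double G" for g x c and u v :: "('g, 'k) dbl"
    using that by (auto simp: \<beta>_def Double_def)
  have 1: "(\<beta>s G I :: ('g, 'k) form) ws = 0" if "\<not> (length ws = n \<and> set ws \<subseteq> Double G)" for ws
    using that n
  proof (induction I arbitrary: n ws)
    case (Cons p I)
    show ?case
    proof (cases ws)
      case (Cons w ws')
      then show ?thesis using Cons.prems Cons.IH[of ws' "length I"]
        by (cases p) (auto simp: tensor_Cons \<beta>_def)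
    qed (simp add: tensor_Cons)
  qed (auto simp: tensor_Nil)
  have 2: "\<beta>s G I (us @ (\<lambda>p. c * u p + v p) # vs) = c * \<beta>s G I (us @ u # vs) + \<beta>s G I (us @ v # vs)"
    if "u \<in> Double G" "v \<in> Double G" for us vs u v and c :: 'k
  proof (induction us arbitrary: I)
    case Nil
    then show ?case using that
      by (cases I) (auto simp: tensor_Cons tensor_Nil \<beta> distrib_right)
  next
    case (Cons w us)
    then show ?case
      by (cases I) (auto simp: tensor_Cons tensor_Nil algebra_simps)
  qed
  show ?thesis unfolding tensor_power_def using 1 2 by blast
qed

lemma map_tensor_linear:
  "map_tensor G m n \<Phi> \<Psi> (\<lambda>ws. c * S ws + T ws) =
    (\<lambda>ws. c * map_tensor G m n \<Phi> \<Psi> S ws + map_tensor G m n \<Phi> \<Psi> T ws)"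
  unfolding map_tensor_def by (simp add: sum_distrib_left sum.distrib algebra_simps)

lemma m_F_linear:
  "m_F G (\<lambda>ws. c * S ws + T ws) = (\<lambda>ws. c * m_F G S ws + m_F G T ws)"
  unfolding m_F_def by (simp add: sum_distrib_left sum.distrib algebra_simps)

lemma \<Delta>_F_linear:
  "\<Delta>_F G (\<lambda>ws. c * S ws + T ws) = (\<lambda>ws. c * \<Delta>_F G S ws + \<Delta>_F G T ws)"
  unfolding \<Delta>_F_def by (simp add: sum_distrib_left sum.distrib algebra_simps)

lemma \<rho>_KF_linear:
  "\<rho>_KF G (\<lambda>ws. c * S ws + T ws) = (\<lambda>ws. c * \<rho>_KF G S ws + \<rho>_KF G T ws)"
  unfolding \<rho>_KF_def by (simp add: sum_distrib_left sum.distrib algebra_simps)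

lemma Cor1_linear:
  "Cor1 G (\<lambda>ws. c * S ws + T ws) = (\<lambda>ws. c * Cor1 G S ws + Cor1 G T ws)"
  by (simp add: Cor1_def map_tensor_linear m_F_linear)

lemma Cor_linear:
  "Cor G n (\<lambda>ws. c * S ws + T ws) = (\<lambda>ws. c * Cor G n S ws + Cor G n T ws)"
  by (induction n rule: induct_nat_012) (simp_all add: Cor1_linear map_tensor_linear)

end

theory Submission
  imports Defs
begin

text \<open>
  Only the summand \<open>a = k x\<^sup>-\<^sup>1\<close> of the coproduct of \<open>\<beta>\<^bsub>k|z\<^esub>\<close> survives the action of
  \<open>\<beta>\<^bsub>g|x\<^esub> \<otimes> \<beta>\<^bsub>h|y\<^esub>\<close>, and the product then has first index
  \<open>k x\<^sup>-\<^sup>1 (g\<^sup>-\<^sup>1 x g) = k [x, g]\<close>, while the second index stays \<open>z\<close>.  So iterating the map only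
  multiplies \<open>k\<close> by commutators, the last tensor factor of \<open>K\<close> acting first.
\<close>

text \<open>The structure maps come with the one-line law for \<open>c * S + T\<close>; this extends
  it to sums, so that maps can be pushed through the sum in the coproduct.\<close>

lemma linear_form_sum:
  fixes \<Phi> :: "('a \<Rightarrow> 'k::comm_ring_1) \<Rightarrow> ('b \<Rightarrow> 'k)"
  assumes linear: "\<And>c S T. \<Phi> (\<lambda>w. c * S w + T w) = (\<lambda>w. c * \<Phi> S w + \<Phi> T w)"
  shows "\<Phi> (\<lambda>w. \<Sum>a\<in>A. c a * S a w) = (\<lambda>w. \<Sum>a\<in>A. c a * \<Phi> (S a) w)"
proof -
  have zero: "\<Phi> (\<lambda>_. 0) = (\<lambda>_. 0)"
    using linear[of "-1" "\<lambda>_. 0" "\<lambda>_. 0"] by simp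
  show ?thesis
    \<comment> \<open>Over an infinite \<open>A\<close> both sums are 0 by convention, so
      \<open>zero\<close> settles that case too.\<close>
    by (induction A rule: infinite_finite_induct) (simp_all add: zero linear)
qed

lemma linear_form_scale:
  fixes \<Phi> :: "('a \<Rightarrow> 'k::comm_ring_1) \<Rightarrow> ('b \<Rightarrow> 'k)"
  assumes "\<And>c S T. \<Phi> (\<lambda>w. c * S w + T w) = (\<lambda>w. c * \<Phi> S w + \<Phi> T w)"
  shows "\<Phi> (\<lambda>w. c * S w) = (\<lambda>w. c * \<Phi> S w)"
  using linear_form_sum[of \<Phi> "\<lambda>_. c" "\<lambda>_. S" "{()}", OF assms] by simp

lemma form_tensor_linear_left:
  "(\<lambda>ws. c * S ws + S' ws) \<otimes>\<^sub>t T = (\<lambda>ws. c * (S \<otimes>\<^sub>t T) ws + (S' \<otimes>\<^sub>t T) ws)"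
  by (simp add: form_tensor_def sum_distrib_left sum.distrib algebra_simps)

lemma form_tensor_linear_right:
  "S \<otimes>\<^sub>t (\<lambda>ws. c * T ws + T' ws) = (\<lambda>ws. c * (S \<otimes>\<^sub>t T) ws + (S \<otimes>\<^sub>t T') ws)"
  by (simp add: form_tensor_def sum_distrib_left sum.distrib algebra_simps)

lemma form_tensor_scale_left: "(\<lambda>ws. c * S ws) \<otimes>\<^sub>t T = (\<lambda>ws. c * (S \<otimes>\<^sub>t T) ws)"
  by (rule linear_form_scale[of "\<lambda>S. S \<otimes>\<^sub>t T"]) (rule form_tensor_linear_left)

lemma form_tensor_scale_right: "S \<otimes>\<^sub>t (\<lambda>ws. c * T ws) = (\<lambda>ws. c * (S \<otimes>\<^sub>t T) ws)"
  by (rule linear_form_scale[of "\<lambda>T. S \<otimes>\<^sub>t T"]) (rule form_tensor_linear_right)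

lemma form_tensor_sum_right:
  "S \<otimes>\<^sub>t (\<lambda>ws. \<Sum>a\<in>A. T a ws) = (\<lambda>ws. \<Sum>a\<in>A. (S \<otimes>\<^sub>t T a) ws)"
  using linear_form_sum[of "\<lambda>T. S \<otimes>\<^sub>t T" "\<lambda>_. 1" T, OF form_tensor_linear_right] by simp

lemma map_tensor_sum:
  "map_tensor G m n \<Phi> \<Psi> (\<lambda>ws. \<Sum>a\<in>A. T a ws) = (\<lambda>ws. \<Sum>a\<in>A. map_tensor G m n \<Phi> \<Psi> (T a) ws)"
  using linear_form_sum[of "map_tensor G m n \<Phi> \<Psi>" "\<lambda>_. 1" T, OF map_tensor_linear] by simp

lemma m_F_sum: "m_F G (\<lambda>ws. \<Sum>a\<in>A. c a * T a ws) = (\<lambda>ws. \<Sum>a\<in>A. c a * m_F G (T a) ws)"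
  by (rule linear_form_sum) (rule m_F_linear)

lemma Cor1_scale: "Cor1 G (\<lambda>ws. c * T ws) = (\<lambda>ws. c * Cor1 G T ws)"
  by (rule linear_form_scale) (rule Cor1_linear)

context group
begin

text \<open>Turns the condition under which the action is nonzero into the first delta of the
  theorem: cancel \<open>y\<close> on the right, then \<open>z\<close> on the left.\<close>

lemma eq_conj_mult_iff:
  assumes "x \<in> carrier G" "y \<in> carrier G" "z \<in> carrier G"
  shows "z = x \<otimes> z \<otimes> y \<longleftrightarrow> inv y = inv z \<otimes> x \<otimes> z"
proof -
  have "z = x \<otimes> z \<otimes> y \<longleftrightarrow> x \<otimes> z = z \<otimes> inv y"
    using assms by (metis inv_solve_right inv_closed inv_inv m_closed)
  also have "\<dots> \<longleftrightarrow> inv y = inv z \<otimes> (x \<otimes> z)"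
    using assms by (metis inv_solve_left inv_closed m_closed)
  finally show ?thesis using assms by (simp add: m_assoc)
qed

text \<open>Used with \<open>w\<close> the conjugate of \<open>h\<close> by \<open>y\<close>: the
  product requires equal second indices, and this rewrites that equality as the second
  delta.\<close>

lemma inv_mult_eq_iff:
  assumes "g \<in> carrier G" "z \<in> carrier G" "w \<in> carrier G"
  shows "inv g \<otimes> z \<otimes> w = z \<longleftrightarrow> w = inv z \<otimes> g \<otimes> z"
proof -
  have "inv g \<otimes> z \<otimes> w = z \<longleftrightarrow> z \<otimes> w = g \<otimes> z"
    using assms by (metis inv_solve_left inv_closed inv_inv m_assoc m_closed)
  also have "\<dots> \<longleftrightarrow> w = inv z \<otimes> (g \<otimes> z)"
    using assms by (metis inv_solve_left m_closed)
  finally show ?thesis using assms by (simp add: m_assoc)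
qed

text \<open>Solves the action's condition on the first coproduct leg for the summation variable
  \<open>a\<close>.\<close>

lemma inv_mult_eq_swap:
  assumes "a \<in> carrier G" "k \<in> carrier G" "x \<in> carrier G"
  shows "inv a \<otimes> k = x \<longleftrightarrow> k \<otimes> inv x = a"
  using assms by (metis inv_solve_left inv_solve_right m_closed)

text \<open>Three deltas arise, two from the action and one from the product. The one involving
  \<open>k\<close> is used up by collapsing the coproduct sum; the other two remain.\<close>

lemma Cor1_basis:
  fixes g x h y k z :: 'a
  assumes fin: "finite (carrier G)" and "g \<in> carrier G" "x \<in> carrier G"
    "h \<in> carrier G" "y \<in> carrier G" "k \<in> carrier G" "z \<in> carrier G"
  shows "(Cor1 G (tensor [\<beta> G g x, \<beta> G h y, \<beta> G k z]) :: ('a, 'k::field) form) =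
    (\<lambda>ws. kron (inv y) (inv z \<otimes> x \<otimes> z) * kron (inv y \<otimes> h \<otimes> y) (inv z \<otimes> g \<otimes> z) *
      tensor [\<beta> G (k \<otimes> commutator G x g) z] ws)"
proof -
  note G = assms(2-)
  let ?w = "inv g \<otimes> z \<otimes> inv y \<otimes> h \<otimes> y"
  let ?u = "inv g \<otimes> x \<otimes> g"
  let ?c = "\<lambda>a. kron z (x \<otimes> z \<otimes> y) * kron (inv a \<otimes> k) x :: 'k"
  have w: "?w \<in> carrier G" and u: "?u \<in> carrier G" using G by auto
  have "map_tensor G 2 1 id (\<Delta>_F G) (tensor [\<beta> G g x, \<beta> G h y, \<beta> G k z]) =
      tensor [\<beta> G g x, \<beta> G h y] \<otimes>\<^sub>t \<Delta>_F G (tensor [\<beta> G k z])"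
    using map_tensor_basis[OF fin, of "[(g, x), (h, y)]" 2 "[(k, z)]" 1 id "\<Delta>_F G"] G
    by (simp add: idx_def)
  also have "\<dots> = (\<lambda>ws. \<Sum>a\<in>carrier G.
      tensor [\<beta> G g x, \<beta> G h y, \<beta> G (inv a \<otimes> k) z, \<beta> G a z] ws :: 'k)"
    by (simp add: \<Delta>_F_basis[OF fin G(5,6)] form_tensor_sum_right flip: tensor_append)
  finally have coprod: "map_tensor G 2 1 id (\<Delta>_F G) (tensor [\<beta> G g x, \<beta> G h y, \<beta> G k z]) =
      (\<lambda>ws. \<Sum>a\<in>carrier G. tensor [\<beta> G g x, \<beta> G h y, \<beta> G (inv a \<otimes> k) z, \<beta> G a z] ws :: 'k)" .
  \<comment> \<open>The four factors are regrouped as 3 + 1: \<open>K\<close> acts on the first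
    coproduct leg, and the second leg passes through unchanged.\<close>
  have act: "map_tensor G 3 1 (\<rho>_KF G) id
      (tensor [\<beta> G g x, \<beta> G h y, \<beta> G (inv a \<otimes> k) z, \<beta> G a z]) =
      (\<lambda>ws. ?c a * tensor [\<beta> G ?u ?w, \<beta> G a z] ws)" if a: "a \<in> carrier G" for a
  proof -
    have "map_tensor G 3 1 (\<rho>_KF G) id
        (tensor [\<beta> G g x, \<beta> G h y, \<beta> G (inv a \<otimes> k) z, \<beta> G a z]) =
        \<rho>_KF G (tensor [\<beta> G g x, \<beta> G h y, \<beta> G (inv a \<otimes> k) z]) \<otimes>\<^sub>t (tensor [\<beta> G a z] :: ('a, 'k) form)"
      using map_tensor_basis[OF fin, of "[(g, x), (h, y), (inv a \<otimes> k, z)]" 3 "[(a, z)]" 1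
          "\<rho>_KF G" id] G a
      by (simp add: idx_def)
    also have "\<dots> = (\<lambda>ws. ?c a * (tensor [\<beta> G ?u ?w] \<otimes>\<^sub>t tensor [\<beta> G a z]) ws)"
      using G a by (simp add: \<rho>_KF_basis[OF fin] form_tensor_scale_left)
    finally show ?thesis by (simp flip: tensor_append)
  qed
  have "Cor1 G (tensor [\<beta> G g x, \<beta> G h y, \<beta> G k z]) =
      m_F G (\<lambda>ws. \<Sum>a\<in>carrier G. ?c a * tensor [\<beta> G ?u ?w, \<beta> G a z] ws)"
    by (simp add: Cor1_def coprod map_tensor_sum act del: One_nat_def cong: sum.cong)
  \<comment> \<open>\<open>m_F\<close> multiplies first indices in reverse order, so
    \<open>a\<close> lands to the left of \<open>?u\<close>.\<close>
  also have "\<dots> = (\<lambda>ws. \<Sum>a\<in>carrier G. ?c a * (kron ?w z * tensor [\<beta> G (a \<otimes> ?u) ?w] ws))"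
    using G w u by (simp add: m_F_sum m_F_basis[OF fin] cong: sum.cong)
  \<comment> \<open>The factor \<open>kron ?w z\<close> permits replacing the second index
    \<open>?w\<close> by \<open>z\<close>.\<close>
  also have "\<dots> = (\<lambda>ws. \<Sum>a\<in>carrier G. kron (k \<otimes> inv x) a *
      (kron z (x \<otimes> z \<otimes> y) * kron ?w z * tensor [\<beta> G (a \<otimes> ?u) z] ws))"
    using G by (intro ext sum.cong refl) (auto simp: kron_def inv_mult_eq_swap)
  also have "\<dots> = (\<lambda>ws. kron z (x \<otimes> z \<otimes> y) * kron ?w z * tensor [\<beta> G (k \<otimes> inv x \<otimes> ?u) z] ws)"
    using G by (simp add: sum_kron_left[OF fin])
  also have "kron z (x \<otimes> z \<otimes> y) = (kron (inv y) (inv z \<otimes> x \<otimes> z) :: 'k)"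
    using eq_conj_mult_iff[of x y z] G by (simp add: kron_def)
  also have "kron ?w z = (kron (inv y \<otimes> h \<otimes> y) (inv z \<otimes> g \<otimes> z) :: 'k)"
    using inv_mult_eq_iff[of g z "inv y \<otimes> h \<otimes> y"] G by (simp add: kron_def m_assoc)
  also have "k \<otimes> inv x \<otimes> ?u = k \<otimes> commutator G x g"
    using G by (simp add: commutator_def m_assoc)
  finally show ?thesis .
qed

lemma commutator_closed:
  "x \<in> carrier G \<Longrightarrow> g \<in> carrier G \<Longrightarrow> commutator G x g \<in> carrier G"
  by (simp add: commutator_def)

lemma foldr_commutator_closed:
  assumes "\<And>i. i \<in> set L \<Longrightarrow> g i \<in> carrier G \<and> x i \<in> carrier G" and "k \<in> carrier G"
  shows "foldr (\<lambda>i a. a \<otimes> commutator G (x i) (g i)) L k \<in> carrier G"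
  using assms by (induction L) (auto simp: commutator_closed)

text \<open>Arbitrary index lists replace 1, ..., n because \<open>Cor\<close> peels off the first
  copy of \<open>K\<close>, leaving indices that no longer start at 1. The induction begins with
  one-element lists, where \<open>Cor\<close> is \<open>Cor1\<close>.\<close>

lemma Cor_basis:
  fixes g x h y :: "'i \<Rightarrow> 'a" and k z :: 'a
  assumes fin: "finite (carrier G)" and "L \<noteq> []"
    and "\<And>i. i \<in> set L \<Longrightarrow>
      g i \<in> carrier G \<and> x i \<in> carrier G \<and> h i \<in> carrier G \<and> y i \<in> carrier G"
    and k: "k \<in> carrier G" and z: "z \<in> carrier G"
  shows "(Cor G (length L) (\<beta>s G (concat (map (\<lambda>i. [(g i, x i), (h i, y i)]) L) @ [(k, z)]))
      :: ('a, 'k::field) form) =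
    (\<lambda>ws. prod_list (map (\<lambda>i. kron (inv (y i)) (inv z \<otimes> x i \<otimes> z) *
        kron (inv (y i) \<otimes> h i \<otimes> y i) (inv z \<otimes> g i \<otimes> z)) L) *
      tensor [\<beta> G (foldr (\<lambda>i a. a \<otimes> commutator G (x i) (g i)) L k) z] ws)"
  using assms(2,3)
proof (induction L rule: list_nonempty_induct)
  case (single i)
  then show ?case using k z by (simp add: Cor1_basis[OF fin])
next
  case (cons i L)
  let ?p = "\<lambda>i. kron (inv (y i)) (inv z \<otimes> x i \<otimes> z) *
        kron (inv (y i) \<otimes> h i \<otimes> y i) (inv z \<otimes> g i \<otimes> z) :: 'k"
  let ?k = "foldr (\<lambda>i a. a \<otimes> commutator G (x i) (g i)) L k"
  let ?I = "concat (map (\<lambda>i. [(g i, x i), (h i, y i)]) L) @ [(k, z)]"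
  have i: "g i \<in> carrier G" "x i \<in> carrier G" "h i \<in> carrier G" "y i \<in> carrier G"
    using cons.prems by auto
  have k': "?k \<in> carrier G" using cons.prems k by (intro foldr_commutator_closed) auto
  \<comment> \<open>Each copy of \<open>K\<close> contributes two tensor factors, and the final
    \<open>F\<close> one.\<close>
  have I: "?I \<in> idx G (2 * length L + 1)"
    using cons.prems k z by (auto simp: idx_def length_concat o_def sum_list_triv)
  \<comment> \<open>This makes the length of \<open>i # L\<close> match the recursive clause of
    \<open>Cor\<close>.\<close>
  obtain n where n: "length L = Suc n" using cons.hyps by (cases L) auto
  have "Cor G (length (i # L)) (\<beta>s G ([(g i, x i), (h i, y i)] @ ?I)) =
      Cor1 G (map_tensor G 2 (2 * length L + 1) id (Cor G (length L))
        (\<beta>s G ([(g i, x i), (h i, y i)] @ ?I)) :: ('a, 'k) form)"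
    by (simp add: n)
  also have "\<dots> = Cor1 G (\<beta>s G [(g i, x i), (h i, y i)] \<otimes>\<^sub>t Cor G (length L) (\<beta>s G ?I))"
    using map_tensor_basis[OF fin _ I, of "[(g i, x i), (h i, y i)]" 2
        "id :: ('a, 'k) form \<Rightarrow> ('a, 'k) form"
        "Cor G (length L) :: ('a, 'k) form \<Rightarrow> ('a, 'k) form"] i
    by (simp add: idx_def)
  \<comment> \<open>By induction the inner map returns a scalar times a single basis vector, with
    \<open>k\<close> replaced by \<open>?k\<close> and \<open>z\<close> unchanged.\<close>
  also have "\<dots> = Cor1 G (\<lambda>ws. prod_list (map ?p L) *
      (\<beta>s G [(g i, x i), (h i, y i)] \<otimes>\<^sub>t tensor [\<beta> G ?k z]) ws)"
    using cons.IH cons.prems by (simp add: form_tensor_scale_right)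
  also have "\<dots> = (\<lambda>ws. prod_list (map ?p L) *
      Cor1 G (tensor [\<beta> G (g i) (x i), \<beta> G (h i) (y i), \<beta> G ?k z]) ws)"
    by (simp add: Cor1_scale flip: tensor_append)
  \<comment> \<open>The new deltas depend on \<open>z\<close> but not on \<open>?k\<close>, so they
    have the same shape at every stage; the head's commutator is appended last, on the
    right.\<close>
  also have "\<dots> = (\<lambda>ws. prod_list (map ?p (i # L)) *
      tensor [\<beta> G (?k \<otimes> commutator G (x i) (g i)) z] ws)"
    using i k' z by (simp add: Cor1_basis[OF fin] mult_ac)
  finally show ?case by simp
qed

end

theorem mainTheorem1:
  fixes G :: "('g, 'm) monoid_scheme" (structure)
    and n :: nat
    and g x h y :: "nat \<Rightarrow> 'g"
    and k z :: 'g
  assumes "group G" and "finite (carrier G)" and "n \<ge> 1"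
    and "\<And>i. i \<in> {1..n} \<Longrightarrow>
      g i \<in> carrier G \<and> x i \<in> carrier G \<and> h i \<in> carrier G \<and> y i \<in> carrier G"
    and "k \<in> carrier G" and "z \<in> carrier G"
  shows "(Cor G n :: ('g, 'k::alg_closed_field) form \<Rightarrow> ('g, 'k) form)
      (tensor (concat (map (\<lambda>i. [\<beta> G (g i) (x i), \<beta> G (h i) (y i)]) [1..<Suc n]) @ [\<beta> G k z]))
    = (\<lambda>ws. (\<Prod>i = 1..n. kron (inv (y i)) (inv z \<otimes> x i \<otimes> z) *
                           kron (inv (y i) \<otimes> h i \<otimes> y i) (inv z \<otimes> g i \<otimes> z)) *
        tensor [\<beta> G (foldl (\<otimes>) k (map (\<lambda>i. commutator G (x i) (g i)) (rev [1..<Suc n]))) z] ws)"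
proof -
  interpret group G by fact
  have "concat (map (\<lambda>i. [\<beta> G (g i) (x i), \<beta> G (h i) (y i)]) L) @ [\<beta> G k z] =
      map (\<lambda>(g, x). \<beta> G g x :: ('g, 'k) dbl \<Rightarrow> 'k)
        (concat (map (\<lambda>i. [(g i, x i), (h i, y i)]) L) @ [(k, z)])" for L
    by (induction L) auto
  \<comment> \<open>Folding from the right consumes the largest index first, which gives the
    descending order of the commutators after \<open>k\<close>.\<close>
  moreover have "foldr (\<lambda>i a. a \<otimes> commutator G (x i) (g i)) L k =
      foldl (\<otimes>) k (map (\<lambda>i. commutator G (x i) (g i)) (rev L))" for L
    by (simp add: foldr_conv_foldl foldl_map)
  moreover have "prod_list (map f [1..<Suc n]) = (\<Prod>i = 1..n. f i)" for f :: "nat \<Rightarrow> 'k"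
    by (simp add: prod.distinct_set_conv_list[symmetric] atLeastLessThanSuc_atLeastAtMost
        del: upt_Suc)
  ultimately show ?thesis
    using Cor_basis[of "[1..<Suc n]" g x h y k z, where 'k = 'k] assms
    by (simp add: atLeastLessThanSuc_atLeastAtMost del: upt_Suc)
qed

end
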